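(* Let $\theta:\mathbb{N}\to\mathbb{R}\cup\{\infty\}$ satisfy $\theta(1)\ge 2$ and $\theta(n)\ge P^+(n)$ for all $n\ge 2$. Let $\mathcal{B}$ and $\mathcal{D}$ be as in the context, with counting functions $B(x)$, $D(x)$. (i) $\mathcal{D}\subseteq\mathcal{B}$, hence $D(x)\le B(x)$. (ii) If moreover $\theta(n)\le\theta(n+1)$ for all $n\ge1$ and $m\theta(n)\le\theta(mn)$ for all $n,m\ge1$ with $\gcd(n,m)=1$, then $\mathcal{D}=\mathcal{B}$, hence $D(x)=B(x)$.
   Context: $P^+(n)$ is the largest prime factor of $n\ge2$. $\mathcal{B}$ is the set of positive integers consisting of $1$ and all $n\ge2$ with factorization $n=p_1^{\alpha_1}\cdots p_k^{\alpha_k}$, $p_1<\cdots<p_k$, such that $p_{j+1}\le\theta(p_1^{\alpha_1}\cdots p_j^{\alpha_j})$ for $0\le j<k$ (empty product $=1$). $\mathcal{D}$ is the set of positive integers consisting of $1$ and all $n\ge2$ whose divisors $1=d_1<d_2<\cdots<d_{\tau(n)}=n$ satisfy $d_{j+1}\le\theta(d_j)$ for $1\le j<\tau(n)$. $B(x)$, $D(x)$ count elements $\le x$ of $\mathcal{B}$, $\mathcal{D}$ respectively. *)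

theory Defs
  imports "HOL-Library.Extended_Real" "HOL-Computational_Algebra.Primes"
begin

text \<open>Only meaningful for \<open>n \<ge> 2\<close>.\<close>
definition largest_prime_factor :: "nat \<Rightarrow> nat" where
  "largest_prime_factor n = Max (prime_factors n)"

text \<open>The increasing lists below are indexed from \<open>0\<close>, so \<open>p\<^sub>j\<^sub>+\<^sub>1\<close> is
  \<open>primes_of n ! j\<close> and \<open>d\<^sub>j\<^sub>+\<^sub>1\<close> is \<open>divisors_of n ! j\<close>.\<close>

definition primes_of :: "nat \<Rightarrow> nat list" where
  "primes_of n = sorted_list_of_set (prime_factors n)"

definition divisors_of :: "nat \<Rightarrow> nat list" where
  "divisors_of n = sorted_list_of_set {d. d dvd n}"

text \<open>The product \<open>p\<^sub>1\<^bsup>\<alpha>\<^sub>1\<^esup> \<cdots> p\<^sub>j\<^bsup>\<alpha>\<^sub>j\<^esup>\<close> over the \<open>j\<close> smallest primes dividing \<open>n\<close>.\<close>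
definition initial_part :: "nat \<Rightarrow> nat \<Rightarrow> nat" where
  "initial_part n j = (\<Prod>i<j. (primes_of n ! i) ^ multiplicity (primes_of n ! i) n)"

definition B_set :: "(nat \<Rightarrow> ereal) \<Rightarrow> nat set" where
  "B_set \<theta> = {1} \<union> {n. n \<ge> 2 \<and>
     (\<forall>j < length (primes_of n). ereal (real (primes_of n ! j)) \<le> \<theta> (initial_part n j))}"

definition D_set :: "(nat \<Rightarrow> ereal) \<Rightarrow> nat set" where
  "D_set \<theta> = {1} \<union> {n. n \<ge> 2 \<and>
     (\<forall>j. Suc j < length (divisors_of n) \<longrightarrow>
        ereal (real (divisors_of n ! Suc j)) \<le> \<theta> (divisors_of n ! j))}"

definition count_upto :: "nat set \<Rightarrow> real \<Rightarrow> nat" where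
  "count_upto A x = card {n \<in> A. real n \<le> x}"

end

theory Submission
  imports Defs
begin

text \<open>
  Membership in \<open>\<D>\<close> says that every divisor \<open>d < n\<close> of \<open>n\<close> is followed by a divisor
  \<open>d'\<close> with \<open>d < d' \<le> \<theta>(d)\<close>.

  (i) Write \<open>n = m r\<close>, where \<open>m\<close> collects the primes below \<open>p = p\<^sub>j\<^sub>+\<^sub>1\<close>. If \<open>\<theta>(m) < p\<close>, the
  divisor following \<open>m\<close> would be less than \<open>p\<close>, hence coprime to \<open>r\<close>, hence a divisor of \<open>m\<close>,
  which is absurd.

  (ii) The gap property passes from \<open>m\<close> to \<open>m p\<^sup>a\<close> if \<open>p \<nmid> m\<close> and \<open>p \<le> \<theta>(m)\<close>. For a divisor
  \<open>e p\<^sup>b\<close> with \<open>e < m\<close>, multiply the successor of \<open>e\<close> in \<open>m\<close> by \<open>p\<^sup>b\<close>. For \<open>m p\<^sup>b\<close> with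
  \<open>b < a\<close>, use \<open>p\<^sup>b\<^sup>+\<^sup>1\<close> if \<open>p > m\<close>. If \<open>p \<le> m\<close>, let \<open>e\<^sub>0\<close> be the largest divisor of \<open>m\<close> with
  \<open>e\<^sub>0 p \<le> m\<close> and \<open>e\<close> its successor; then \<open>e p\<^sup>b\<^sup>+\<^sup>1 > m p\<^sup>b\<close>, while
  \<open>e p\<^sup>b\<^sup>+\<^sup>1 \<le> p\<^sup>b\<^sup>+\<^sup>1 \<theta>(e\<^sub>0) \<le> \<theta>(e\<^sub>0 p\<^sup>b\<^sup>+\<^sup>1) \<le> \<theta>(m p\<^sup>b)\<close>.
\<close>

section \<open>Membership in \<open>D_set\<close> through gaps between divisors\<close>

definition divisor_gaps :: "(nat \<Rightarrow> ereal) \<Rightarrow> nat \<Rightarrow> bool" where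
  "divisor_gaps \<theta> n \<longleftrightarrow>
     (\<forall>d. d dvd n \<and> d < n \<longrightarrow> (\<exists>d'. d' dvd n \<and> d < d' \<and> ereal (real d') \<le> \<theta> d))"

text \<open>The next divisor after \<open>d\<close> is the least one exceeding \<open>d\<close>, so
  as soon as some larger divisor obeys the bound, the next one does too. This frees later arguments
  about divisors from list positions.\<close>

lemma divisor_gaps_iff_divisors_of:
  assumes "n > 0"
  shows "divisor_gaps \<theta> n \<longleftrightarrow>
     (\<forall>j. Suc j < length (divisors_of n) \<longrightarrow>
        ereal (real (divisors_of n ! Suc j)) \<le> \<theta> (divisors_of n ! j))"
    (is "_ \<longleftrightarrow> ?R")
proof -
  let ?ds = "divisors_of n"
  have set: "set ?ds = {d. d dvd n}"
    using assms by (simp add: divisors_of_def)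
  have sorted: "sorted_wrt (<) ?ds"
    by (simp add: divisors_of_def)
  have less: "?ds ! i < ?ds ! j" if "i < j" "j < length ?ds" for i j
    using sorted that by (rule sorted_wrt_nth_less)
  have less_iff: "?ds ! i < ?ds ! j \<longleftrightarrow> i < j" if "i < length ?ds" "j < length ?ds" for i j
    using less[of i j] less[of j i] that by (cases i j rule: linorder_cases) auto
  have index: "\<exists>i < length ?ds. ?ds ! i = d" if "d dvd n" for d
    using that set by (metis in_set_conv_nth mem_Collect_eq)
  have nth: "?ds ! i dvd n" if "i < length ?ds" for i
    using that set nth_mem by blast
  show ?thesis
  proof
    assume gaps: "divisor_gaps \<theta> n"
    show ?R
    proof (intro allI impI)
      fix j assume j: "Suc j < length ?ds"
      have "?ds ! j < ?ds ! Suc j" using less j by simp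
      also have "\<dots> \<le> n" using nth[OF j] assms by (simp add: dvd_imp_le)
      finally obtain d' where d': "d' dvd n" "?ds ! j < d'" "ereal (real d') \<le> \<theta> (?ds ! j)"
        using gaps nth[of j] j unfolding divisor_gaps_def by auto
      obtain k where k: "k < length ?ds" "?ds ! k = d'" using index d'(1) by blast
      then have "j < k" using d'(2) less_iff j by auto
      then have "?ds ! Suc j \<le> d'"
        using k less[of "Suc j" k] by (cases "Suc j = k") auto
      then show "ereal (real (?ds ! Suc j)) \<le> \<theta> (?ds ! j)"
        using d'(3) by (meson ereal_less_eq(3) of_nat_le_iff order_trans)
    qed
  next
    assume R: ?R
    show "divisor_gaps \<theta> n"
      unfolding divisor_gaps_def
    proof (intro allI impI)
      fix d assume d: "d dvd n \<and> d < n"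
      obtain j where j: "j < length ?ds" "?ds ! j = d" using index d by blast
      obtain k where k: "k < length ?ds" "?ds ! k = n" using index[of n] by auto
      have "j < k" using less_iff[of j k] j k d by simp
      then have "Suc j < length ?ds" using k by simp
      then show "\<exists>d'. d' dvd n \<and> d < d' \<and> ereal (real d') \<le> \<theta> d"
        using R nth[of "Suc j"] less[of j "Suc j"] j by auto
    qed
  qed
qed

lemma D_set_iff_divisor_gaps: "n \<in> D_set \<theta> \<longleftrightarrow> n > 0 \<and> divisor_gaps \<theta> n"
proof (cases "n \<ge> 2")
  case True
  then show ?thesis by (simp add: D_set_def divisor_gaps_iff_divisors_of)
next
  case False
  then have "n = 0 \<or> n = 1" by auto
  then show ?thesis by (auto simp: D_set_def divisor_gaps_def)
qed

section \<open>Products over the smallest primes of a number\<close>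

lemma primes_of_less: "i < j \<Longrightarrow> j < length (primes_of n) \<Longrightarrow> primes_of n ! i < primes_of n ! j"
  by (rule sorted_wrt_nth_less[of "(<)"]) (simp_all add: primes_of_def)

lemma prime_primes_of: "i < length (primes_of n) \<Longrightarrow> prime (primes_of n ! i)"
  using nth_mem[of i "primes_of n"] by (auto simp: primes_of_def)

lemma initial_part_Suc:
  "initial_part n (Suc j) =
     initial_part n j * (primes_of n ! j) ^ multiplicity (primes_of n ! j) n"
  by (simp add: initial_part_def)

lemma initial_part_length:
  assumes "n > 0"
  shows "initial_part n (length (primes_of n)) = n"
proof -
  have "initial_part n (length (primes_of n)) = (\<Prod>p\<in>prime_factors n. p ^ multiplicity p n)"
    unfolding initial_part_def
    by (rule prod.reindex_bij_betw[OF bij_betw_nth]) (simp_all add: primes_of_def)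
  also have "\<dots> = n"
    using assms prime_factorization_nat[of n] by simp
  finally show ?thesis .
qed

lemma initial_part_pos: "j \<le> length (primes_of n) \<Longrightarrow> initial_part n j > 0"
  unfolding initial_part_def
  by (intro prod_pos) (auto intro!: prime_gt_0_nat prime_primes_of)

lemma coprime_primes_of_initial_part:
  assumes "j < length (primes_of n)"
  shows "coprime (primes_of n ! j) (initial_part n j)"
  unfolding initial_part_def
proof (rule prod_coprime_right)
  fix i assume "i \<in> {..<j}"
  then have "primes_of n ! i \<noteq> primes_of n ! j"
    using primes_of_less[of i j n] assms by auto
  then show "coprime (primes_of n ! j) (primes_of n ! i ^ multiplicity (primes_of n ! i) n)"
    using \<open>i \<in> {..<j}\<close> assms by (auto intro!: primes_coprime prime_primes_of)
qed

lemma initial_part_split: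
  assumes "n > 0" "j \<le> length (primes_of n)"
  shows "n = initial_part n j *
    (\<Prod>i=j..<length (primes_of n). (primes_of n ! i) ^ multiplicity (primes_of n ! i) n)"
proof -
  have "n = initial_part n (length (primes_of n))"
    using assms(1) by (simp add: initial_part_length)
  also have "\<dots> = initial_part n j *
    (\<Prod>i=j..<length (primes_of n). (primes_of n ! i) ^ multiplicity (primes_of n ! i) n)"
    using assms(2) by (simp add: initial_part_def lessThan_atLeast0 prod.atLeastLessThan_concat)
  finally show ?thesis .
qed

text \<open>Every prime of the complementary factor is at least \<open>primes_of n ! j\<close>,
  hence exceeds \<open>d\<close> and cannot divide it. So \<open>d\<close> is coprime to that factor
  and must divide the other one.\<close>

lemma dvd_initial_part:
  assumes "n > 0" "j < length (primes_of n)" "d dvd n" "d < primes_of n ! j"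
  shows "d dvd initial_part n j"
proof -
  have "d > 0" using assms(1,3) by (auto intro: Nat.gr0I)
  have "coprime d (\<Prod>i=j..<length (primes_of n).
      (primes_of n ! i) ^ multiplicity (primes_of n ! i) n)"
  proof (rule prod_coprime_right)
    fix i assume i: "i \<in> {j..<length (primes_of n)}"
    then have "primes_of n ! j \<le> primes_of n ! i"
      using primes_of_less[of j i n] by (cases "i = j") auto
    then have "\<not> primes_of n ! i dvd d"
      using assms(4) \<open>d > 0\<close> by (auto dest: dvd_imp_le)
    then have "coprime (primes_of n ! i) d"
      using i by (intro prime_imp_coprime prime_primes_of) auto
    then show "coprime d (primes_of n ! i ^ multiplicity (primes_of n ! i) n)"
      by (simp add: coprime_commute)
  qed
  then show ?thesis
    using assms(3) initial_part_split[of n j] assms(1,2)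
    by (metis coprime_dvd_mult_left_iff less_imp_le)
qed

section \<open>From divisor gaps to the condition on primes\<close>

lemma D_set_subset_B_set: "D_set \<theta> \<subseteq> B_set \<theta>"
proof
  fix n assume n: "n \<in> D_set \<theta>"
  then have pos: "n > 0" and gaps: "divisor_gaps \<theta> n"
    by (simp_all add: D_set_iff_divisor_gaps)
  have "ereal (real (primes_of n ! j)) \<le> \<theta> (initial_part n j)" if j: "j < length (primes_of n)" for j
  proof (rule ccontr)
    let ?p = "primes_of n ! j" and ?m = "initial_part n j"
    assume less: "\<not> ereal (real ?p) \<le> \<theta> ?m"
    have "?m dvd n" using initial_part_split[OF pos, of j] j by (metis dvd_triv_left less_imp_le)
    moreover have "?p dvd n"
      using nth_mem[OF j] pos by (auto simp: primes_of_def)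
    \<comment> \<open>Equality would make \<open>?p\<close> a divisor of \<open>?m\<close> as well
      as coprime to it, hence a unit.\<close>
    then have "?m \<noteq> n"
      using coprime_primes_of_initial_part[OF j] prime_primes_of[OF j]
      by (metis coprime_absorb_left not_prime_unit)
    ultimately have "?m < n" using pos by (simp add: dvd_imp_le le_neq_implies_less)
    with gaps \<open>?m dvd n\<close> obtain d where d: "d dvd n" "?m < d" "ereal (real d) \<le> \<theta> ?m"
      unfolding divisor_gaps_def by blast
    have "ereal (real d) < ereal (real ?p)" using d(3) less by (meson not_le order_le_less_trans)
    then have "d dvd ?m" using dvd_initial_part[OF pos j d(1)] by simp
    then show False
      using d(2) initial_part_pos[of j n] j by (auto dest: dvd_imp_le)
  qed
  then show "n \<in> B_set \<theta>"
    using pos by (auto simp: B_set_def)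
qed

section \<open>From the condition on primes to divisor gaps\<close>

lemma divisor_gaps_mult_prime_power:
  fixes \<theta> :: "nat \<Rightarrow> ereal"
  assumes mono: "\<And>m n. 1 \<le> m \<Longrightarrow> m \<le> n \<Longrightarrow> \<theta> m \<le> \<theta> n"
    and mult: "\<And>n m. 1 \<le> n \<Longrightarrow> 1 \<le> m \<Longrightarrow> coprime n m \<Longrightarrow> ereal (real m) * \<theta> n \<le> \<theta> (m * n)"
    and m: "m > 0" and p: "prime p" "coprime p m" "ereal (real p) \<le> \<theta> m"
    and gaps: "divisor_gaps \<theta> m"
  shows "divisor_gaps \<theta> (m * p ^ a)"
proof -
  have ppos: "p > 0" using p(1) by (rule prime_gt_0_nat)
  \<comment> \<open>A bound between divisors of \<open>m\<close> survives multiplication by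
    \<open>p ^ b\<close>, because \<open>p\<close> is coprime to every divisor of
    \<open>m\<close>.\<close>
  have scale: "ereal (real (p ^ b * e')) \<le> \<theta> (p ^ b * e)"
    if "e dvd m" "ereal (real e') \<le> \<theta> e" for b e e'
  proof -
    have "e > 0" using that(1) m by (auto intro: Nat.gr0I)
    have "coprime e (p ^ b)"
      using p(2) that(1) by (meson coprime_commute coprime_divisors coprime_power_right_iff dvd_refl)
    have "ereal (real (p ^ b * e')) = ereal (real (p ^ b)) * ereal (real e')" by simp
    also have "\<dots> \<le> ereal (real (p ^ b)) * \<theta> e"
      by (rule ereal_mult_left_mono[OF that(2)]) simp
    also have "\<dots> \<le> \<theta> (p ^ b * e)"
      using \<open>e > 0\<close> \<open>coprime e (p ^ b)\<close> ppos by (intro mult) auto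
    finally show ?thesis .
  qed
  show ?thesis
    unfolding divisor_gaps_def
  proof (intro allI impI, elim conjE)
    fix d assume d: "d dvd m * p ^ a" "d < m * p ^ a"
    obtain e q where eq: "d = e * q" "e dvd m" "q dvd p ^ a"
      using d(1) by (rule division_decomp[THEN exE]) auto
    obtain b where b: "b \<le> a" "q = p ^ b"
      using eq(3) p(1) by (auto simp: divides_primepow_nat)
    show "\<exists>d'. d' dvd m * p ^ a \<and> d < d' \<and> ereal (real d') \<le> \<theta> d"
    proof (cases "e = m")
      case False
      then have "e < m" using eq(2) m by (simp add: dvd_imp_le le_neq_implies_less)
      then obtain e' where e': "e' dvd m" "e < e'" "ereal (real e') \<le> \<theta> e"
        using gaps eq(2) unfolding divisor_gaps_def by blast
      have "p ^ b * e' dvd m * p ^ a"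
        using e'(1) b(1) by (metis le_imp_power_dvd mult.commute mult_dvd_mono)
      moreover have "d < p ^ b * e'" using e'(2) eq(1) b(2) ppos by (simp add: mult.commute)
      moreover have "ereal (real (p ^ b * e')) \<le> \<theta> d"
        using scale[OF eq(2) e'(3), of b] eq(1) b(2) by (simp add: mult.commute)
      ultimately show ?thesis by blast
    next
      case True
      with d(2) eq(1) b have "b < a" by (auto simp: le_less)
      then have dvd: "p ^ Suc b dvd p ^ a" by (intro le_imp_power_dvd) simp
      have d_eq: "d = p ^ b * m" using True eq(1) b(2) by simp
      show ?thesis
      proof (cases "m < p")
        case True
        have "p ^ Suc b dvd m * p ^ a" using dvd by simp
        moreover have "d < p ^ Suc b" using True ppos d_eq by simp
        \<comment> \<open>Here \<open>scale\<close> is applied to \<open>m\<close> as a divisor of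
          itself, with \<open>p\<close> in place of the successor.\<close>
        moreover have "ereal (real (p ^ Suc b)) \<le> \<theta> d"
          using scale[OF dvd_refl p(3), of b] d_eq by (simp add: mult.commute)
        ultimately show ?thesis by blast
      next
        case False
        \<comment> \<open>The set contains 1 because \<open>p\<close> \<le> \<open>m\<close>. Its
          maximum \<open>c\<close> satisfies \<open>c * p\<close> \<le> \<open>m\<close> with
          \<open>p\<close> > 1, so \<open>c\<close> < \<open>m\<close> and the gap property of
          \<open>m\<close> applies to \<open>c\<close>.\<close>
        define S where "S = {e. e dvd m \<and> e * p \<le> m}"
        have "finite S" using m by (simp add: S_def)
        moreover have "1 \<in> S" using False by (simp add: S_def)
        ultimately have "Max S \<in> S" by (metis Max_in empty_iff)
        define c where "c = Max S"
        have c: "c dvd m" "c * p \<le> m" using \<open>Max S \<in> S\<close> by (auto simp: c_def S_def)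
        have "c > 0" using c(1) m by (auto intro: Nat.gr0I)
        have "c * 1 < c * p" using \<open>c > 0\<close> prime_gt_1_nat[OF p(1)] by simp
        with c obtain e' where e': "e' dvd m" "c < e'" "ereal (real e') \<le> \<theta> c"
          using gaps unfolding divisor_gaps_def by (metis mult.right_neutral order_less_le_trans)
        have "e' \<notin> S" using e'(2) Max_ge[OF \<open>finite S\<close>, of e'] by (auto simp: c_def)
        then have "m < e' * p" using e'(1) by (auto simp: S_def)
        then have "d < p ^ Suc b * e'" using d_eq ppos by (simp add: mult.commute mult.left_commute)
        moreover have "p ^ Suc b * e' dvd m * p ^ a"
          using e'(1) dvd by (metis mult.commute mult_dvd_mono)
        \<comment> \<open>Scaling gives a bound by \<open>\<theta>\<close> at
          \<open>p ^ Suc b * c\<close>; as this point does not exceed \<open>d\<close>, monotonicity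
          carries the bound over to \<open>d\<close>.\<close>
        moreover have "p ^ Suc b * c \<le> d"
          using c(2) d_eq by (simp add: mult.commute mult.left_commute)
        then have "\<theta> (p ^ Suc b * c) \<le> \<theta> d"
          using \<open>c > 0\<close> ppos by (intro mono) (auto simp: Suc_le_eq)
        then have "ereal (real (p ^ Suc b * e')) \<le> \<theta> d"
          using scale[OF c(1) e'(3), of "Suc b"] by (rule order_trans[rotated])
        ultimately show ?thesis by blast
      qed
    qed
  qed
qed

lemma B_set_subset_D_set:
  fixes \<theta> :: "nat \<Rightarrow> ereal"
  assumes mono: "\<And>m n. 1 \<le> m \<Longrightarrow> m \<le> n \<Longrightarrow> \<theta> m \<le> \<theta> n"
    and mult: "\<And>n m. 1 \<le> n \<Longrightarrow> 1 \<le> m \<Longrightarrow> coprime n m \<Longrightarrow> ereal (real m) * \<theta> n \<le> \<theta> (m * n)"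
  shows "B_set \<theta> \<subseteq> D_set \<theta>"
proof
  fix n assume n: "n \<in> B_set \<theta>"
  show "n \<in> D_set \<theta>"
  proof (cases "n = 1")
    case True
    then show ?thesis by (simp add: D_set_def)
  next
    case False
    with n have pos: "n > 0"
      and B: "\<And>j. j < length (primes_of n) \<Longrightarrow>
        ereal (real (primes_of n ! j)) \<le> \<theta> (initial_part n j)"
      by (auto simp: B_set_def)
    \<comment> \<open>The number is built up from 1 by one prime power at a time, in increasing
      order of the primes; the last stage is \<open>n\<close> itself.\<close>
    have "divisor_gaps \<theta> (initial_part n j)" if "j \<le> length (primes_of n)" for j
      using that
    proof (induction j)
      case 0
      then show ?case by (simp add: initial_part_def divisor_gaps_def)
    next
      case (Suc j)
      then have "j < length (primes_of n)" by simp
      with Suc show ?case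
        unfolding initial_part_Suc
        by (intro divisor_gaps_mult_prime_power[OF mono mult] initial_part_pos prime_primes_of
            coprime_primes_of_initial_part B) auto
    qed
    from this[of "length (primes_of n)"] show ?thesis
      using pos by (simp add: initial_part_length D_set_iff_divisor_gaps)
  qed
qed

section \<open>Comparison of the counting functions\<close>

lemma count_upto_mono:
  assumes "A \<subseteq> B"
  shows "count_upto A x \<le> count_upto B x"
  unfolding count_upto_def
proof (rule card_mono)
  \<comment> \<open>Finiteness matters because \<open>card\<close> is 0 on infinite sets.\<close>
  show "finite {n \<in> B. real n \<le> x}"
    by (rule finite_subset[of _ "{..nat \<lfloor>x\<rfloor>}"]) (auto simp: le_nat_floor)
qed (use assms in auto)

theorem theorem2p5:
  fixes \<theta> :: "nat \<Rightarrow> ereal"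
  assumes "\<theta> 1 \<ge> 2"
    and "\<And>n. n \<ge> 2 \<Longrightarrow> \<theta> n \<ge> ereal (real (largest_prime_factor n))"
  shows "(D_set \<theta> \<subseteq> B_set \<theta> \<and>
           (\<forall>x. count_upto (D_set \<theta>) x \<le> count_upto (B_set \<theta>) x)) \<and>
         ((\<forall>n\<ge>1. \<theta> n \<le> \<theta> (n + 1)) \<and>
          (\<forall>n\<ge>1. \<forall>m\<ge>1. coprime n m \<longrightarrow> ereal (real m) * \<theta> n \<le> \<theta> (m * n))
          \<longrightarrow> D_set \<theta> = B_set \<theta> \<and>
              (\<forall>x. count_upto (D_set \<theta>) x = count_upto (B_set \<theta>) x))"
proof (intro conjI allI impI)
  show "D_set \<theta> \<subseteq> B_set \<theta>" by (rule D_set_subset_B_set)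
  show "count_upto (D_set \<theta>) x \<le> count_upto (B_set \<theta>) x" for x
    by (rule count_upto_mono[OF D_set_subset_B_set])
  assume *: "(\<forall>n\<ge>1. \<theta> n \<le> \<theta> (n + 1)) \<and>
    (\<forall>n\<ge>1. \<forall>m\<ge>1. coprime n m \<longrightarrow> ereal (real m) * \<theta> n \<le> \<theta> (m * n))"
  have "\<theta> m \<le> \<theta> n" if "1 \<le> m" "m \<le> n" for m n
    using that(2)
  proof (induction n rule: dec_induct)
    case (step k)
    then have "\<theta> k \<le> \<theta> (Suc k)" using * that(1) by auto
    with step.IH show ?case by (rule order_trans)
  qed simp
  then have "B_set \<theta> \<subseteq> D_set \<theta>"
    using * by (intro B_set_subset_D_set) auto
  then show eq: "D_set \<theta> = B_set \<theta>" using D_set_subset_B_set by blast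
  show "count_upto (D_set \<theta>) x = count_upto (B_set \<theta>) x" for x
    by (simp add: eq)
qed

end
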